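(* For every $\mathbf{x}\mathbf{y}$-word $\mathbf{v}$, the $f$-polynomial of the descent polytope $\mathrm{DP}_{\mathbf{v}}$ is given by $$F_{\mathbf{v}}(t)=1+\sum_{(\mathbf{u}_1,\dots,\mathbf{u}_{k-1},\mathbf{u}_k)}(t+1)^k,$$ where the sum ranges over all $k\ge 1$ and all factorizations $\mathbf{v}=\mathbf{u}_1\cdots\mathbf{u}_{k-1}\cdot\mathbf{u}_k$ of the word $\mathbf{v}$ such that each of the factors $\mathbf{u}_1,\dots,\mathbf{u}_{k-1}$ is of the form $\mathbf{x}^i\mathbf{y}$ or $\mathbf{y}^i\mathbf{x}$ for some $i\ge 0$, and there is no condition on the last factor $\mathbf{u}_k$ (in particular $\mathbf{u}_k$ may be the empty word).
   Context: An $\mathbf{x}\mathbf{y}$-word is a finite (possibly empty) word in the two letters $\mathbf{x},\mathbf{y}$; products denote concatenation and powers denote repetition. Descent polytope: for an $\mathbf{x}\mathbf{y}$-word $\mathbf{v}=\mathbf{v}_1\cdots\mathbf{v}_{n-1}$ of length $n-1$ ($n\ge 1$), $\mathrm{DP}_{\mathbf{v}}\subset\mathbb{R}^n$ is the set of points $(x_1,\dots,x_n)$ with $0\le x_i\le 1$ for all $i$, and, for $1\le i\le n-1$, $x_i\le x_{i+1}$ if $\mathbf{v}_i=\mathbf{x}$ and $x_i\ge x_{i+1}$ if $\mathbf{v}_i=\mathbf{y}$. $f$-polynomial: $F_{\mathbf{v}}(t)=\sum_{\mathcal F} t^{\dim\mathcal F}$, the sum being over all nonempty faces $\mathcal F$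 of $\mathrm{DP}_{\mathbf{v}}$, including $\mathrm{DP}_{\mathbf{v}}$ itself. *)

theory Defs
  imports "HOL-Analysis.Analysis" "HOL-Computational_Algebra.Polynomial"
begin

datatype letter = LX | LY

type_synonym xyword = "letter list"

text \<open>
  The ambient space is \<open>real ^ 'n\<close>.  The map \<open>e\<close> numbers the coordinates, from 0: it is meant to be
  a bijection from \<open>{..length v}\<close> to the index type, so that the dimension is \<open>length v + 1\<close>, and
  the point \<open>(x_1, ..., x_n)\<close> is the vector \<open>x\<close> with \<open>x_(i+1) = x $ e i\<close>.  Likewise the
  letter \<open>v_(i+1)\<close> is \<open>v ! i\<close>.
\<close>

definition descent_polytope :: "(nat \<Rightarrow> 'n::finite) \<Rightarrow> xyword \<Rightarrow> (real ^ 'n) set" where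
  "descent_polytope e v =
     {x. (\<forall>i \<le> length v. 0 \<le> x $ e i \<and> x $ e i \<le> 1) \<and>
         (\<forall>i < length v. case v ! i of
            LX \<Rightarrow> x $ e i \<le> x $ e (Suc i)
          | LY \<Rightarrow> x $ e i \<ge> x $ e (Suc i))}"

text \<open>
  Here \<open>nat\<close> loses nothing, since \<open>aff_dim\<close> is nonnegative on nonempty sets.  The sum would be
  0 if there were infinitely many faces; a polytope has only finitely many.
\<close>

definition f_polynomial :: "'a::euclidean_space set \<Rightarrow> int poly" where
  "f_polynomial P = (\<Sum>F \<in> {F. F face_of P \<and> F \<noteq> {}}. monom 1 (nat (aff_dim F)))"

definition special_word :: "xyword \<Rightarrow> bool" where
  "special_word u \<longleftrightarrow> (\<exists>i. u = replicate i LX @ [LY] \<or> u = replicate i LY @ [LX])"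

text \<open>
  A factorization \<open>(u_1, ..., u_k)\<close> is the list of its factors, so \<open>k\<close> is the length.  There are
  finitely many, as every factor but the last is nonempty.
\<close>

definition factorizations :: "xyword \<Rightarrow> xyword list set" where
  "factorizations v =
     {us. us \<noteq> [] \<and> concat us = v \<and> (\<forall>u \<in> set (butlast us). special_word u)}"

end

theory Submission
  imports Defs
begin

text \<open>
  The nonempty faces of a polyhedron given by finitely many linear inequalities correspond to the sets
  of inequalities that are tight at some point of it, and the dimension of a face is the dimension of
  the space on which the linear forms of its tight inequalities vanish
  (\<open>f_polynomial_eq_sum_over_codes\<close>).  For the descent polytope the inequalities tight at
  \<open>x\<close> record which coordinates are 0, which are 1, and which neighbours are equal.  This is the same
  as cutting the sequence \<open>x_1, ..., x_n\<close> into maximal runs of equal values and marking each run as 0, 1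
  or interior; the dimension is the number of interior runs, because their values can be moved
  independently (\<open>dim_tied_coordinates\<close>).

  Such a cutting is written as a word in four symbols: \<open>Zero\<close>, \<open>One\<close>, \<open>Fresh\<close> for the first coordinate
  of an interior run and \<open>Same\<close> for a later one.  A word of symbols comes from a point of the polytope
  exactly if each pair of neighbouring symbols is compatible with the letter between them, since there
  is always room for a new value strictly between the current one and 0 or 1
  (\<open>encode_admissible\<close>).  So the \<open>f\<close>-polynomial is a product of transfer matrices: with \<open>Z\<close>, \<open>I\<close>, \<open>O\<close>
  the enumerators by the number of \<open>Fresh\<close> symbols of the continuations along \<open>v\<close> of a coordinate that
  is 0, interior or 1, it is \<open>F = Z + t I + O\<close>, and prepending \<open>x\<close> to \<open>v\<close> replaces \<open>(Z, I, O)\<close> by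
  \<open>(F, (1 + t) I + O, O)\<close>; prepending \<open>y\<close> acts symmetrically.

  On the other side let \<open>G\<close> be the sum over the factorizations of \<open>v\<close>.  A factorization of
  \<open>x v\<close> has a single factor, or its first factor is \<open>x\<close>, or \<open>x\<close> followed by a word \<open>x^i y\<close> at the
  beginning of \<open>v\<close>; hence, on prepending \<open>x\<close>, \<open>G\<close> becomes \<open>(1 + t) (1 + G) + A\<close>, where \<open>A\<close> is the sum
  over the factorizations of \<open>v\<close> that begin with such a factor and have at least one more.  The
  theorem \<open>F = 1 + G\<close> follows by induction on \<open>v\<close>, together with \<open>F = 1 + A + (1 + t) Z\<close>, its mirror
  image for \<open>O\<close>, and the linear relation \<open>I + 1 = Z + O\<close> (\<open>transfer_identities\<close>).
\<close>

section \<open>Nonempty faces of a polyhedron\<close>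

locale linear_inequalities =
  fixes C :: "'c set" and a :: "'c \<Rightarrow> 'a::euclidean_space" and b :: "'c \<Rightarrow> real"
  assumes finite_C: "finite C"
begin

definition solutions :: "'a set" where
  "solutions = {x. \<forall>c\<in>C. a c \<bullet> x \<le> b c}"

definition tight :: "'a \<Rightarrow> 'c set" where
  "tight x = {c \<in> C. a c \<bullet> x = b c}"

definition tight_face :: "'a \<Rightarrow> 'a set" where
  "tight_face x = {y \<in> solutions. tight x \<subseteq> tight y}"

lemma tight_face_face_of: "tight_face x face_of solutions"
proof -
  have conv: "convex solutions"
  proof -
    have "solutions = (\<Inter>c\<in>C. {x. a c \<bullet> x \<le> b c})"
      by (auto simp: solutions_def)
    then show ?thesis
      by (simp add: convex_INT convex_halfspace_le)
  qed
  let ?S = "insert solutions ((\<lambda>c. solutions \<inter> {y. a c \<bullet> y = b c}) ` tight x)"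
  have "tight_face x = \<Inter> ?S"
    by (auto simp: tight_face_def tight_def)
  moreover have "\<Inter> ?S face_of solutions"
  proof (rule face_of_Inter)
    fix T assume "T \<in> ?S"
    then consider "T = solutions" | c where "c \<in> tight x" "T = solutions \<inter> {y. a c \<bullet> y = b c}"
      by auto
    then show "T face_of solutions"
    proof cases
      case 1 then show ?thesis by (simp add: conv face_of_refl)
    next
      case 2
      show ?thesis unfolding 2(2)
        by (rule face_of_Int_supporting_hyperplane_le[OF conv])
          (use 2(1) in \<open>auto simp: solutions_def tight_def\<close>)
    qed
  qed simp
  ultimately show ?thesis by simp
qed

text \<open>
  The inequalities that are not tight at \<open>x\<close> stay strict on a neighbourhood of \<open>x\<close>, so near \<open>x\<close> only the
  tight equations cut out the face.  Both the relative interior and the dimension of the face are read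
  off from this.
\<close>

lemma tight_face_locally_flat:
  assumes "x \<in> solutions"
  obtains U where "open U" "x \<in> U" "U \<inter> {y. \<forall>c\<in>tight x. a c \<bullet> y = b c} \<subseteq> tight_face x"
proof
  let ?U = "\<Inter>c\<in>C - tight x. {y. a c \<bullet> y < b c}"
  show "open ?U"
    using finite_C by (intro open_INT) (auto simp: open_halfspace_lt)
  show "x \<in> ?U"
    using assms by (force simp: solutions_def tight_def)
  show "?U \<inter> {y. \<forall>c\<in>tight x. a c \<bullet> y = b c} \<subseteq> tight_face x"
  proof
    fix y assume y: "y \<in> ?U \<inter> {y. \<forall>c\<in>tight x. a c \<bullet> y = b c}"
    have "a c \<bullet> y \<le> b c" if "c \<in> C" for c
      using y that by (cases "c \<in> tight x") (auto intro: less_imp_le)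
    moreover have "tight x \<subseteq> tight y"
      using y by (auto simp: tight_def)
    ultimately show "y \<in> tight_face x"
      by (simp add: tight_face_def solutions_def)
  qed
qed

lemma affine_tight_flat: "affine {y. \<forall>c\<in>T. a c \<bullet> y = b c}"
proof -
  have "{y. \<forall>c\<in>T. a c \<bullet> y = b c} = (\<Inter>c\<in>T. {y. a c \<bullet> y = b c})" by auto
  then show ?thesis by (auto simp: affine_hyperplane)
qed

text \<open>
  The affine hull of the face lies in the flat of the tight equations, and the face fills that flat
  near \<open>x\<close>.
\<close>

lemma rel_interior_tight_face:
  assumes "x \<in> solutions"
  shows "x \<in> rel_interior (tight_face x)"
proof -
  let ?A = "{y. \<forall>c\<in>tight x. a c \<bullet> y = b c}"
  obtain U where U: "open U" "x \<in> U" "U \<inter> ?A \<subseteq> tight_face x"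
    using tight_face_locally_flat[OF assms] .
  have "affine hull (tight_face x) \<subseteq> ?A"
    by (rule hull_minimal[where S = affine, OF _ affine_tight_flat]) (auto simp: tight_face_def tight_def)
  with U have "U \<inter> affine hull (tight_face x) \<subseteq> tight_face x" by blast
  moreover have "x \<in> tight_face x" using assms by (simp add: tight_face_def)
  ultimately show ?thesis using U by (auto simp: mem_rel_interior)
qed

text \<open>
  A nonempty face has a point \<open>x\<close> in its relative interior.  The face and \<open>tight_face x\<close> then have
  intersecting relative interiors, which forces two faces to coincide.
\<close>

lemma nonempty_face_iff_tight_face:
  "F face_of solutions \<and> F \<noteq> {} \<longleftrightarrow> F \<in> tight_face ` solutions"
proof
  assume F: "F face_of solutions \<and> F \<noteq> {}"
  then have "rel_interior F \<noteq> {}"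
    by (meson face_of_imp_convex rel_interior_eq_empty)
  then obtain x where x: "x \<in> rel_interior F" by auto
  then have xs: "x \<in> solutions"
    using F face_of_imp_subset rel_interior_subset by blast
  have "F = tight_face x"
    by (rule face_of_eq[of _ solutions])
      (use F x rel_interior_tight_face[OF xs] tight_face_face_of in auto)
  with xs show "F \<in> tight_face ` solutions" by blast
next
  assume "F \<in> tight_face ` solutions"
  then show "F face_of solutions \<and> F \<noteq> {}"
    using tight_face_face_of by (auto simp: tight_face_def)
qed

lemma aff_dim_tight_face:
  assumes "x \<in> solutions"
  shows "aff_dim (tight_face x) = int (dim {y. \<forall>c\<in>tight x. a c \<bullet> y = 0})"
proof -
  let ?A = "{y. \<forall>c\<in>tight x. a c \<bullet> y = b c}" and ?V = "{y. \<forall>c\<in>tight x. a c \<bullet> y = 0}"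
  obtain U where U: "open U" "x \<in> U" "U \<inter> ?A \<subseteq> tight_face x"
    using tight_face_locally_flat[OF assms] .
  have xA: "x \<in> ?A" by (simp add: tight_def)
  have "?A \<inter> U \<noteq> {}" using U(2) xA by blast
  then have "affine hull (?A \<inter> U) = affine hull ?A"
    by (rule affine_hull_affine_Int_open[OF affine_tight_flat U(1)])
  then have "aff_dim ?A = aff_dim (?A \<inter> U)"
    by (rule aff_dim_affine_hull2[symmetric])
  also have "\<dots> \<le> aff_dim (tight_face x)"
    by (rule aff_dim_subset) (use U in blast)
  finally have "aff_dim ?A \<le> aff_dim (tight_face x)" .
  moreover have "aff_dim (tight_face x) \<le> aff_dim ?A"
    by (rule aff_dim_subset) (auto simp: tight_face_def tight_def)
  moreover have "?A = (+) x ` ?V"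
  proof (intro equalityI subsetI)
    fix y assume "y \<in> ?A"
    then have "y - x \<in> ?V" using xA by (simp add: inner_diff_right)
    then have "x + (y - x) \<in> (+) x ` ?V" by blast
    then show "y \<in> (+) x ` ?V" by simp
  qed (use xA in \<open>auto simp: inner_add_right\<close>)
  moreover have "subspace ?V"
    by (auto simp: subspace_def inner_add_right)
  ultimately show ?thesis
    by (simp add: aff_dim_translation_eq aff_dim_subspace)
qed

lemma tight_face_eq_iff:
  assumes "x \<in> solutions" "y \<in> solutions"
  shows "tight_face x = tight_face y \<longleftrightarrow> tight x = tight y"
proof
  assume "tight_face x = tight_face y"
  with assms have "x \<in> tight_face y" "y \<in> tight_face x" by (auto simp: tight_face_def)
  then show "tight x = tight y" by (auto simp: tight_face_def)
qed (simp add: tight_face_def)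

text \<open>
  The faces may be counted by any code \<open>\<tau>\<close> of points that distinguishes exactly the tight sets, and
  any function \<open>d\<close> that recovers the dimension from the code.
\<close>

lemma f_polynomial_eq_sum_over_codes:
  fixes \<tau> :: "'a \<Rightarrow> 'p" and d :: "'p \<Rightarrow> nat"
  assumes code: "\<And>x y. x \<in> solutions \<Longrightarrow> y \<in> solutions \<Longrightarrow> \<tau> x = \<tau> y \<longleftrightarrow> tight x = tight y"
    and dim: "\<And>x. x \<in> solutions \<Longrightarrow> dim {y. \<forall>c\<in>tight x. a c \<bullet> y = 0} = d (\<tau> x)"
  shows "f_polynomial solutions = (\<Sum>p \<in> \<tau> ` solutions. monom 1 (d p))"
proof -
  define \<rho> where "\<rho> = inv_into solutions \<tau>"
  have \<rho>: "\<rho> (\<tau> x) \<in> solutions" "\<tau> (\<rho> (\<tau> x)) = \<tau> x" if "x \<in> solutions" for x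
    using that by (auto simp: \<rho>_def inv_into_into f_inv_into_f)
  have face_\<rho>: "tight_face (\<rho> (\<tau> x)) = tight_face x" if "x \<in> solutions" for x
    using code[OF \<rho>(1)[OF that] that] \<rho>[OF that] by (simp add: tight_face_eq_iff that)
  have "bij_betw (tight_face \<circ> \<rho>) (\<tau> ` solutions) {F. F face_of solutions \<and> F \<noteq> {}}"
    unfolding bij_betw_def
  proof
    show "inj_on (tight_face \<circ> \<rho>) (\<tau> ` solutions)"
      by (rule inj_onI) (auto simp: face_\<rho> tight_face_eq_iff code)
    have "(tight_face \<circ> \<rho>) ` \<tau> ` solutions = tight_face ` solutions"
      by (simp add: image_image face_\<rho>)
    then show "(tight_face \<circ> \<rho>) ` \<tau> ` solutions = {F. F face_of solutions \<and> F \<noteq> {}}"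
      by (simp only: nonempty_face_iff_tight_face Collect_mem_eq)
  qed
  then have "f_polynomial solutions =
      (\<Sum>p\<in>\<tau> ` solutions. monom 1 (nat (aff_dim ((tight_face \<circ> \<rho>) p))))"
    unfolding f_polynomial_def by (rule sum.reindex_bij_betw[symmetric])
  also have "\<dots> = (\<Sum>p \<in> \<tau> ` solutions. monom 1 (d p))"
    by (rule sum.cong) (auto simp: aff_dim_tight_face dim \<rho>)
  finally show ?thesis .
qed

end

section \<open>The dimension of a space of tied coordinates\<close>

text \<open>
  A vector of the subspace is determined by its values at the indices that are neither forced to be
  zero nor tied to their predecessor, and these values are arbitrary: the remaining ones are then
  copied from left to right.  The projection to these coordinates is therefore an isomorphism.  The
  hypothesis \<open>zero_tied\<close> ensures that copying never clashes with a coordinate forced to be zero.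
\<close>

lemma dim_tied_coordinates:
  fixes e :: "nat \<Rightarrow> 'n::finite" and zero tied :: "nat \<Rightarrow> bool"
  assumes e: "bij_betw e {..n} (UNIV :: 'n set)"
    and zero_tied: "\<And>i. i < n \<Longrightarrow> tied i \<Longrightarrow> zero i \<longleftrightarrow> zero (Suc i)"
  shows "dim {y :: real ^ 'n. (\<forall>i\<le>n. zero i \<longrightarrow> y $ e i = 0) \<and>
              (\<forall>i<n. tied i \<longrightarrow> y $ e i = y $ e (Suc i))} =
         card {i. i \<le> n \<and> \<not> zero i \<and> (i = 0 \<or> \<not> tied (i - 1))}"
    (is "dim ?V = card ?J")
proof -
  let ?E = "{z :: real ^ 'n. \<forall>k. k \<notin> e ` ?J \<longrightarrow> z $ k = 0}"
  have inj: "inj_on e {..n}" and onto: "\<And>k. \<exists>i\<le>n. k = e i"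
    using e by (auto simp: bij_betw_def)
  have e_in_J: "e i \<in> e ` ?J \<longleftrightarrow> i \<in> ?J" if "i \<le> n" for i
    using inj_on_image_mem_iff[OF inj, of i ?J] that by auto
  define f :: "real ^ 'n \<Rightarrow> real ^ 'n" where "f y = (\<chi> k. if k \<in> e ` ?J then y $ k else 0)" for y
  have lin: "linear f"
    by (rule linearI) (auto simp: f_def vec_eq_iff)
  have sub: "subspace ?V"
    by (auto simp: subspace_def)
  have "inj_on f ?V"
  proof (rule inj_onI)
    fix y y' assume y: "y \<in> ?V" and y': "y' \<in> ?V" and eq: "f y = f y'"
    have J: "y $ e i = y' $ e i" if "i \<in> ?J" for i
    proof -
      have "f y $ e i = f y' $ e i" using eq by simp
      then show ?thesis using that by (auto simp: f_def)
    qed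
    have "y $ e i = y' $ e i" if "i \<le> n" for i
      using that
    proof (induction i)
      case 0
      show ?case
      proof (cases "zero 0")
        case True with y y' show ?thesis by simp
      qed (use J in simp)
    next
      case (Suc i)
      then consider "Suc i \<in> ?J" | "zero (Suc i)" | "tied i" by auto
      then show ?case
      proof cases
        case 1 then show ?thesis by (rule J)
      next
        case 2 with y y' Suc.prems show ?thesis by simp
      next
        case 3
        then have "y $ e (Suc i) = y $ e i" "y' $ e (Suc i) = y' $ e i"
          using y y' Suc.prems by simp_all
        then show ?thesis using Suc by simp
      qed
    qed
    then show "y = y'" using onto by (metis vec_eq_iff)
  qed
  then have "inj_on f (span ?V)" using sub by (simp add: span_eq_iff[THEN iffD2])
  then have "dim (f ` ?V) = dim ?V" using lin by (rule dim_image_eq[rotated])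
  moreover have "f ` ?V = ?E"
  proof (intro equalityI subsetI)
    fix z assume z: "z \<in> ?E"
    \<comment> \<open>The preimage of \<open>z\<close>, built by copying each value to the tied successor.\<close>
    define h where "h = rec_nat (z $ e 0)
      (\<lambda>i r. if Suc i \<in> ?J then z $ e (Suc i) else if tied i then r else 0)"
    have h0: "h 0 = z $ e 0" and hS: "\<And>i. h (Suc i) =
        (if Suc i \<in> ?J then z $ e (Suc i) else if tied i then h i else 0)"
      by (simp_all add: h_def)
    have zero: "h i = 0" if "i \<le> n" "zero i" for i
      using that
    proof (induction i)
      case 0
      then have "e 0 \<notin> e ` ?J" by (subst e_in_J) auto
      with z show ?case by (simp add: h0)
    next
      case (Suc i) then show ?case using zero_tied[of i] by (simp add: hS)
    qed
    have J: "h i = z $ e i" if "i \<in> ?J" for i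
      using that by (cases i) (simp_all add: h0 hS)
    define y :: "real ^ 'n" where "y = (\<chi> k. h (inv_into {..n} e k))"
    have y: "y $ e i = h i" if "i \<le> n" for i
      using that inj by (simp add: y_def)
    have "y \<in> ?V"
      by (auto simp: y zero hS)
    moreover have "f y = z"
      unfolding vec_eq_iff
    proof
      fix k
      obtain i where i: "i \<le> n" "k = e i" using onto by blast
      show "f y $ k = z $ k"
      proof (cases "i \<in> ?J")
        case True
        then have "f y $ k = y $ e i" using i by (auto simp: f_def)
        then show ?thesis using i J[OF True] by (simp add: y)
      next
        case False
        then have "k \<notin> e ` ?J" unfolding i(2) e_in_J[OF i(1)] .
        then show ?thesis using z by (simp add: f_def)
      qed
    qed
    ultimately show "z \<in> f ` ?V" by (intro image_eqI[of z f y]) (simp_all only:)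
  next
    fix z assume "z \<in> f ` ?V"
    then obtain y where "z = f y" by (rule imageE)
    then show "z \<in> ?E" by (simp add: f_def)
  qed
  moreover have "dim ?E = card (e ` ?J)"
    by (subst dim_vec_eq[symmetric]) (rule dim_substandard_cart)
  moreover have "card (e ` ?J) = card ?J"
    by (rule card_image) (rule inj_on_subset[OF inj], auto)
  ultimately show ?thesis by simp
qed

section \<open>Words of symbols realized by sequences of reals\<close>

datatype symbol = Zero | One | Fresh | Same

text \<open>
  The symbol of a coordinate \<open>s\<close> with predecessor \<open>r\<close>.  Whether \<open>s = r\<close> is recorded only for interior
  values; for the values 0 and 1 the symbols of both coordinates tell it.
\<close>

definition symbol_of :: "real \<Rightarrow> real \<Rightarrow> symbol" where
  "symbol_of r s = (if s = 0 then Zero else if s = 1 then One else if s = r then Same else Fresh)"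

text \<open>
  The value \<open>r\<close> plays the role of a coordinate preceding the list.
\<close>

definition encode :: "real \<Rightarrow> real list \<Rightarrow> symbol list" where
  "encode r xs = map2 symbol_of (r # xs) xs"

lemma encode_simps [simp]:
  "encode r [] = []" "encode r (s # ss) = symbol_of r s # encode s ss"
  by (simp_all add: encode_def)

definition in_order :: "letter \<Rightarrow> real \<Rightarrow> real \<Rightarrow> bool" where
  "in_order c r s \<longleftrightarrow> (case c of LX \<Rightarrow> r \<le> s | LY \<Rightarrow> r \<ge> s)"

fun admissible :: "xyword \<Rightarrow> real \<Rightarrow> real list \<Rightarrow> bool" where
  "admissible [] r [] \<longleftrightarrow> True"
| "admissible (c # w) r (s # ss) \<longleftrightarrow>
     0 \<le> s \<and> s \<le> 1 \<and> in_order c r s \<and> admissible w s ss"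
| "admissible _ _ _ \<longleftrightarrow> False"

text \<open>
  The symbols that may follow a coordinate with the given symbol across a letter.  \<open>Fresh\<close> and \<open>Same\<close>
  both mean an interior value and have the same successors.
\<close>

fun successors :: "letter \<Rightarrow> symbol \<Rightarrow> symbol set" where
  "successors LX Zero = {Zero, Fresh, One}"
| "successors LX One = {One}"
| "successors LX _ = {Fresh, Same, One}"
| "successors LY Zero = {Zero}"
| "successors LY One = {Zero, Fresh, One}"
| "successors LY _ = {Zero, Fresh, Same}"

fun patterns :: "xyword \<Rightarrow> symbol \<Rightarrow> symbol list set" where
  "patterns [] q = {[]}"
| "patterns (c # w) q = (\<Union>s\<in>successors c q. (#) s ` patterns w s)"

fun stands_for :: "symbol \<Rightarrow> real \<Rightarrow> bool" where
  "stands_for Zero r \<longleftrightarrow> r = 0"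
| "stands_for One r \<longleftrightarrow> r = 1"
| "stands_for _ r \<longleftrightarrow> 0 < r \<and> r < 1"

lemma stands_for_symbol_of: "0 \<le> s \<Longrightarrow> s \<le> 1 \<Longrightarrow> stands_for (symbol_of r s) s"
  by (auto simp: symbol_of_def)

lemma successors_sound:
  assumes "stands_for q r" "0 \<le> s" "s \<le> 1" "in_order c r s"
  shows "symbol_of r s \<in> successors c q"
  using assms by (cases c; cases q) (auto simp: symbol_of_def in_order_def)

text \<open>
  Only \<open>Fresh\<close> requires a choice of the new value: the midpoint between the old one and 1 or 0 is
  interior, lies on the correct side, and differs from the old value.
\<close>

lemma successors_complete:
  assumes "stands_for q r" "q' \<in> successors c q"
  obtains s where "0 \<le> s" "s \<le> 1" "in_order c r s" "symbol_of r s = q'"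
proof -
  define s where "s = (case q' of Zero \<Rightarrow> 0 | One \<Rightarrow> 1 | Same \<Rightarrow> r
    | Fresh \<Rightarrow> (case c of LX \<Rightarrow> (r + 1) / 2 | LY \<Rightarrow> r / 2))"
  have "0 \<le> s \<and> s \<le> 1 \<and> in_order c r s \<and> symbol_of r s = q'"
    using assms by (cases c; cases q; cases q') (auto simp: s_def symbol_of_def in_order_def field_simps)
  then show ?thesis using that by blast
qed

text \<open>
  A word of symbols is realized by choosing the coordinates from left to right.  No choice can block a
  later one, as the compatible successors depend only on the symbol of a value and not on the value
  itself.
\<close>

lemma encode_admissible:
  assumes "stands_for q r"
  shows "encode r ` {ss. admissible w r ss} = patterns w q"
  using assms
proof (induction w arbitrary: q r)
  case Nil
  have "{ss. admissible [] r ss} = {[]}"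
    by (auto elim: admissible.elims)
  then show ?case by simp
next
  case (Cons c w)
  show ?case
  proof (intro equalityI subsetI)
    fix p assume "p \<in> encode r ` {ss. admissible (c # w) r ss}"
    then obtain xs where xs: "admissible (c # w) r xs" "p = encode r xs" by auto
    then obtain s ss where "xs = s # ss" by (cases xs) auto
    with xs have s: "0 \<le> s" "s \<le> 1" "in_order c r s" "admissible w s ss"
        "p = symbol_of r s # encode s ss"
      by auto
    then have "encode s ss \<in> patterns w (symbol_of r s)"
      using Cons.IH[OF stands_for_symbol_of[of s r]] by blast
    then show "p \<in> patterns (c # w) q"
      using successors_sound[OF Cons.prems s(1-3)] s(5) by auto
  next
    fix p assume "p \<in> patterns (c # w) q"
    then obtain q' p' where q': "q' \<in> successors c q" "p' \<in> patterns w q'" "p = q' # p'" by auto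
    obtain s where s: "0 \<le> s" "s \<le> 1" "in_order c r s" "symbol_of r s = q'"
      using successors_complete[OF Cons.prems q'(1)] .
    have "p' \<in> encode s ` {ss. admissible w s ss}"
      using Cons.IH[of q' s] stands_for_symbol_of[of s r] s q' by simp
    then obtain ss where "p' = encode s ss" "admissible w s ss" by auto
    with s q' show "p \<in> encode r ` {ss. admissible (c # w) r ss}"
      by (intro image_eqI[of _ _ "s # ss"]) auto
  qed
qed

section \<open>Faces of the descent polytope as words of symbols\<close>

datatype inequality = Lower nat | Upper nat | Step nat

fun normal :: "(nat \<Rightarrow> 'n::finite) \<Rightarrow> xyword \<Rightarrow> inequality \<Rightarrow> real ^ 'n" where
  "normal e v (Lower i) = - axis (e i) 1"
| "normal e v (Upper i) = axis (e i) 1"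
| "normal e v (Step i) = (case v ! i of
      LX \<Rightarrow> axis (e i) 1 - axis (e (Suc i)) 1
    | LY \<Rightarrow> axis (e (Suc i)) 1 - axis (e i) 1)"

fun bound :: "inequality \<Rightarrow> real" where
  "bound (Upper i) = 1"
| "bound _ = 0"

definition inequalities :: "nat \<Rightarrow> inequality set" where
  "inequalities n = Lower ` {..n} \<union> Upper ` {..n} \<union> Step ` {..<n}"

lemma ball_inequalities:
  "(\<forall>c\<in>inequalities n. P c) \<longleftrightarrow>
     (\<forall>i\<le>n. P (Lower i)) \<and> (\<forall>i\<le>n. P (Upper i)) \<and> (\<forall>i<n. P (Step i))"
  by (auto simp: inequalities_def)

interpretation dp: linear_inequalities "inequalities n" "normal e v" bound for n e v
  by standard (simp add: inequalities_def)

lemma inner_axis_1: "axis k 1 \<bullet> (y :: real ^ 'n::finite) = y $ k"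
  by (simp add: inner_axis')

lemma inner_normal:
  "normal e v (Lower i) \<bullet> y = - (y $ e i)"
  "normal e v (Upper i) \<bullet> y = y $ e i"
  "normal e v (Step i) \<bullet> y =
     (case v ! i of LX \<Rightarrow> y $ e i - y $ e (Suc i) | LY \<Rightarrow> y $ e (Suc i) - y $ e i)"
  by (simp_all add: inner_axis_1 inner_diff_left split: letter.split)

lemma mem_descent_polytope_iff:
  "x \<in> descent_polytope e v \<longleftrightarrow> (\<forall>i\<le>length v. 0 \<le> x $ e i \<and> x $ e i \<le> 1) \<and>
     (\<forall>i<length v. in_order (v ! i) (x $ e i) (x $ e (Suc i)))"
  by (simp add: descent_polytope_def in_order_def)

lemma descent_polytope_eq_solutions: "descent_polytope e v = dp.solutions (length v) e v"
proof -
  have "normal e v (Step i) \<bullet> x \<le> 0 \<longleftrightarrow> in_order (v ! i) (x $ e i) (x $ e (Suc i))" for i x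
    by (simp add: inner_normal in_order_def del: normal.simps split: letter.split)
  then show ?thesis
    by (auto simp: set_eq_iff mem_descent_polytope_iff dp.solutions_def ball_inequalities inner_normal(1,2)
        simp del: normal.simps)
qed

lemma inner_Step_eq_0_iff: "normal e v (Step i) \<bullet> y = 0 \<longleftrightarrow> y $ e i = y $ e (Suc i)"
  by (auto simp: inner_normal simp del: normal.simps split: letter.split)

lemma tight_eq_iff:
  "dp.tight n e v x = dp.tight n e v y \<longleftrightarrow>
     (\<forall>i\<le>n. (x $ e i = 0 \<longleftrightarrow> y $ e i = 0) \<and> (x $ e i = 1 \<longleftrightarrow> y $ e i = 1)) \<and>
     (\<forall>i<n. x $ e i = x $ e (Suc i) \<longleftrightarrow> y $ e i = y $ e (Suc i))"
proof -
  have "dp.tight n e v x = dp.tight n e v y \<longleftrightarrow> (\<forall>c\<in>inequalities n.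
      normal e v c \<bullet> x = bound c \<longleftrightarrow> normal e v c \<bullet> y = bound c)"
    by (auto simp: dp.tight_def)
  then show ?thesis
    by (auto simp: ball_inequalities inner_normal(1,2) inner_Step_eq_0_iff simp del: normal.simps)
qed

lemma tight_null_space:
  "{y. \<forall>c\<in>dp.tight n e v x. normal e v c \<bullet> y = 0} =
     {y. (\<forall>i\<le>n. x $ e i = 0 \<or> x $ e i = 1 \<longrightarrow> y $ e i = 0) \<and>
         (\<forall>i<n. x $ e i = x $ e (Suc i) \<longrightarrow> y $ e i = y $ e (Suc i))}"
proof -
  have "(\<forall>c\<in>dp.tight n e v x. normal e v c \<bullet> y = 0) \<longleftrightarrow>
      (\<forall>c\<in>inequalities n. normal e v c \<bullet> x = bound c \<longrightarrow> normal e v c \<bullet> y = 0)" for y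
    by (auto simp: dp.tight_def)
  then show ?thesis
    by (auto simp: ball_inequalities inner_normal(1,2) inner_Step_eq_0_iff simp del: normal.simps)
qed

definition coords :: "(nat \<Rightarrow> 'n::finite) \<Rightarrow> nat \<Rightarrow> real ^ 'n \<Rightarrow> real list" where
  "coords e n x = map (\<lambda>i. x $ e i) [0..<Suc n]"

lemma length_coords [simp]: "length (coords e n x) = Suc n"
  by (simp add: coords_def)

lemma nth_coords [simp]: "i \<le> n \<Longrightarrow> coords e n x ! i = x $ e i"
  by (simp add: coords_def del: upt_Suc)

lemma length_encode [simp]: "length (encode r xs) = length xs"
  by (simp add: encode_def)

lemma nth_encode: "i < length xs \<Longrightarrow> encode r xs ! i = symbol_of ((r # xs) ! i) (xs ! i)"
  by (simp add: encode_def)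

lemma admissible_iff_nth:
  "admissible w r ss \<longleftrightarrow> length ss = length w \<and>
     (\<forall>i<length w. 0 \<le> ss ! i \<and> ss ! i \<le> 1 \<and> in_order (w ! i) ((r # ss) ! i) (ss ! i))"
  by (induction w r ss rule: admissible.induct) (auto simp: All_less_Suc2)

text \<open>
  Imagining a further coordinate of value 0 in front, followed by the letter \<open>x\<close>, adds no condition to
  \<open>0 \<le> x_1\<close>.  So the first coordinate needs no special treatment.
\<close>

lemma mem_descent_polytope_iff_admissible:
  "x \<in> descent_polytope e v \<longleftrightarrow> admissible (LX # v) 0 (coords e (length v) x)"
proof -
  have "x \<in> descent_polytope e v \<longleftrightarrow> (\<forall>i<Suc (length v). 0 \<le> x $ e i \<and> x $ e i \<le> 1) \<and>
      (\<forall>i<length v. in_order (v ! i) (x $ e i) (x $ e (Suc i)))"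
    by (simp add: mem_descent_polytope_iff less_Suc_eq_le)
  moreover have "in_order LX 0 (x $ e 0) \<longleftrightarrow> 0 \<le> x $ e 0"
    by (simp add: in_order_def)
  ultimately show ?thesis
    by (auto simp: admissible_iff_nth All_less_Suc2)
qed

text \<open>
  Together with \<open>tight_eq_iff\<close> this says that the word of symbols of a point carries the same
  information as its tight set.
\<close>

lemma encode_coords_eq_iff:
  "encode 0 (coords e n x) = encode 0 (coords e n y) \<longleftrightarrow>
     (\<forall>i\<le>n. (x $ e i = 0 \<longleftrightarrow> y $ e i = 0) \<and> (x $ e i = 1 \<longleftrightarrow> y $ e i = 1)) \<and>
     (\<forall>i<n. x $ e i = x $ e (Suc i) \<longleftrightarrow> y $ e i = y $ e (Suc i))" (is "?l \<longleftrightarrow> ?labels \<and> ?steps")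
proof -
  have sym: "symbol_of r s = symbol_of r' s' \<longleftrightarrow> (s = 0 \<longleftrightarrow> s' = 0) \<and> (s = 1 \<longleftrightarrow> s' = 1) \<and>
      (s \<noteq> 0 \<and> s \<noteq> 1 \<longrightarrow> (r = s \<longleftrightarrow> r' = s'))" for r s r' s'
    by (auto simp: symbol_of_def)
  have "?l \<longleftrightarrow> symbol_of 0 (x $ e 0) = symbol_of 0 (y $ e 0) \<and>
      (\<forall>i<n. symbol_of (x $ e i) (x $ e (Suc i)) = symbol_of (y $ e i) (y $ e (Suc i)))"
    by (simp add: list_eq_iff_nth_eq nth_encode All_less_Suc2)
  also have "\<dots> \<longleftrightarrow> ?labels \<and> (\<forall>i<n. x $ e (Suc i) \<noteq> 0 \<and> x $ e (Suc i) \<noteq> 1 \<longrightarrow>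
      (x $ e i = x $ e (Suc i) \<longleftrightarrow> y $ e i = y $ e (Suc i)))"
    unfolding sym less_Suc_eq_le[symmetric] All_less_Suc2 by auto
  also have "\<dots> \<longleftrightarrow> ?labels \<and> ?steps"
  proof -
    \<comment> \<open>The symbols of a run with value 0 or 1 determine the ties inside it.\<close>
    have "x $ e i = x $ e (Suc i) \<longleftrightarrow> y $ e i = y $ e (Suc i)"
      if "?labels" "i < n" "x $ e (Suc i) = 0 \<or> x $ e (Suc i) = 1" for i
    proof -
      have "i \<le> n" "Suc i \<le> n" using that(2) by simp_all
      then show ?thesis using that(1,3) by metis
    qed
    then show ?thesis by blast
  qed
  finally show ?thesis .
qed

text \<open>
  The free coordinates of the null space are those that start an interior run.
\<close>

lemma dim_eq_count_Fresh:
  fixes e :: "nat \<Rightarrow> 'n::finite"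
  assumes e: "bij_betw e {..n} (UNIV :: 'n set)"
  shows "dim {y. \<forall>c\<in>dp.tight n e v x. normal e v c \<bullet> y = 0} =
         count_list (encode 0 (coords e n x)) Fresh"
proof -
  have "dim {y. \<forall>c\<in>dp.tight n e v x. normal e v c \<bullet> y = 0} =
      card {i. i \<le> n \<and> \<not> (x $ e i = 0 \<or> x $ e i = 1) \<and>
              (i = 0 \<or> \<not> x $ e (i - 1) = x $ e (Suc (i - 1)))}"
    unfolding tight_null_space by (rule dim_tied_coordinates[OF e]) simp
  also have "\<dots> = card {i. i < Suc n \<and> Fresh = encode 0 (coords e n x) ! i}"
  proof (rule arg_cong[where f = card], rule Collect_cong)
    fix i
    show "i \<le> n \<and> \<not> (x $ e i = 0 \<or> x $ e i = 1) \<and>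
              (i = 0 \<or> \<not> x $ e (i - 1) = x $ e (Suc (i - 1))) \<longleftrightarrow>
          i < Suc n \<and> Fresh = encode 0 (coords e n x) ! i"
      by (cases i) (auto simp: nth_encode symbol_of_def split: if_splits)
  qed
  also have "\<dots> = count_list (encode 0 (coords e n x)) Fresh"
    by (simp add: count_list_eq_length_filter length_filter_conv_card)
  finally show ?thesis .
qed

lemma encode_descent_polytope:
  fixes e :: "nat \<Rightarrow> 'n::finite"
  assumes e: "bij_betw e {..length v} (UNIV :: 'n set)"
  shows "(\<lambda>x. encode 0 (coords e (length v) x)) ` descent_polytope e v = patterns (LX # v) Zero"
proof -
  have "coords e (length v) ` descent_polytope e v = {ss. admissible (LX # v) 0 ss}"
  proof (intro equalityI subsetI)
    fix ss assume ss: "ss \<in> {ss. admissible (LX # v) 0 ss}"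
    define x :: "real ^ 'n" where "x = (\<chi> k. ss ! inv_into {..length v} e k)"
    have "coords e (length v) x = ss"
    proof (rule nth_equalityI)
      show "length (coords e (length v) x) = length ss"
        using ss by (simp add: admissible_iff_nth)
      fix i assume "i < length (coords e (length v) x)"
      then show "coords e (length v) x ! i = ss ! i"
        using e by (simp add: x_def bij_betw_def)
    qed
    then show "ss \<in> coords e (length v) ` descent_polytope e v"
      using ss mem_descent_polytope_iff_admissible by blast
  qed (auto simp: mem_descent_polytope_iff_admissible)
  then show ?thesis
    using encode_admissible[of Zero 0 "LX # v"] by (metis (no_types, lifting) image_cong image_image stands_for.simps(1))
qed

section \<open>Transfer recurrences for the enumerators\<close>

text \<open>
  The enumerator, by number of interior runs, of the ways to continue along \<open>w\<close> a coordinate with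
  symbol \<open>q\<close>.
\<close>

definition pattern_poly :: "xyword \<Rightarrow> symbol \<Rightarrow> int poly" where
  "pattern_poly w q = (\<Sum>p\<in>patterns w q. monom 1 (count_list p Fresh))"

lemma finite_patterns: "finite (patterns w q)"
proof (induction w arbitrary: q)
  case (Cons c w)
  have "finite (successors c q)" by (cases c; cases q) auto
  with Cons show ?case by simp
qed simp

lemma pattern_poly_Nil [simp]: "pattern_poly [] q = 1"
  by (simp add: pattern_poly_def)

lemma pattern_poly_Cons:
  "pattern_poly (c # w) q = (\<Sum>s\<in>successors c q. (if s = Fresh then [:0, 1:] else 1) * pattern_poly w s)"
proof -
  have "pattern_poly (c # w) q = (\<Sum>s\<in>successors c q. \<Sum>p\<in>(#) s ` patterns w s. monom 1 (count_list p Fresh))"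
    unfolding pattern_poly_def patterns.simps
    by (rule sum.UNION_disjoint) (cases c; cases q; auto simp: finite_patterns)+
  also have "\<dots> = (\<Sum>s\<in>successors c q. (if s = Fresh then [:0, 1:] else 1) * pattern_poly w s)"
  proof (rule sum.cong[OF refl])
    fix s
    have "(\<Sum>p\<in>(#) s ` patterns w s. monom 1 (count_list p Fresh)) =
        (\<Sum>p\<in>patterns w s. monom 1 (count_list (s # p) Fresh) :: int poly)"
      by (subst sum.reindex) auto
    also have "\<dots> = (if s = Fresh then [:0, 1:] else 1) * pattern_poly w s"
      by (auto simp: pattern_poly_def sum_distrib_left monom_Suc)
    finally show "(\<Sum>p\<in>(#) s ` patterns w s. monom 1 (count_list p Fresh)) =
        (if s = Fresh then [:0, 1:] else 1) * pattern_poly w s" .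
  qed
  finally show ?thesis .
qed

lemma pattern_poly_Same: "pattern_poly w Same = pattern_poly w Fresh"
proof (cases w)
  case (Cons c w')
  have "successors c Same = successors c Fresh" by (cases c) simp_all
  then show ?thesis by (simp add: Cons pattern_poly_Cons)
qed simp

lemma pattern_poly_LX_Zero: "pattern_poly (LX # v) Zero =
      pattern_poly v Zero + [:0, 1:] * pattern_poly v Fresh + pattern_poly v One"
  and pattern_poly_LX_One: "pattern_poly (LX # v) One = pattern_poly v One"
  and pattern_poly_LX_Fresh: "pattern_poly (LX # v) Fresh = ([:0, 1:] + 1) * pattern_poly v Fresh + pattern_poly v One"
  and pattern_poly_LY_Zero: "pattern_poly (LY # v) Zero = pattern_poly v Zero"
  and pattern_poly_LY_One: "pattern_poly (LY # v) One =
      pattern_poly v Zero + [:0, 1:] * pattern_poly v Fresh + pattern_poly v One"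
  and pattern_poly_LY_Fresh: "pattern_poly (LY # v) Fresh = ([:0, 1:] + 1) * pattern_poly v Fresh + pattern_poly v Zero"
  by (simp_all add: pattern_poly_Cons pattern_poly_Same algebra_simps)

section \<open>Factorizations by their first factor\<close>

definition weight :: "xyword list set \<Rightarrow> int poly" where
  "weight S = (\<Sum>us\<in>S. ([:0, 1:] + 1) ^ length us)"

text \<open>
  The factorizations of \<open>v\<close> with at least two factors whose first factor \<open>a^i b\<close> can be extended to the
  left by the letter \<open>a\<close>, giving another special word.
\<close>

definition run_factorizations :: "letter \<Rightarrow> xyword \<Rightarrow> xyword list set" where
  "run_factorizations a v =
     {u # us | u us i b w. u = replicate i a @ [b] \<and> b \<noteq> a \<and> v = u @ w \<and> us \<in> factorizations w}"

definition extend_first_factor :: "'a \<Rightarrow> 'a list list \<Rightarrow> 'a list list" where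
  "extend_first_factor a us = (a # hd us) # tl us"

lemma special_word_Nil: "\<not> special_word []"
  by (auto simp: special_word_def)

text \<open>
  A special word of length at least two ends at the first change of letter, so once its first letter is
  known only its length is open.
\<close>

lemma special_word_Cons:
  "special_word (a # u) \<longleftrightarrow> u = [] \<or> (\<exists>i b. b \<noteq> a \<and> u = replicate i a @ [b])" (is "?l = ?r")
proof
  assume ?l
  then obtain i where "a # u = replicate i LX @ [LY] \<or> a # u = replicate i LY @ [LX]"
    unfolding special_word_def by auto
  then show ?r by (cases i) auto
next
  assume ?r
  then show ?l
  proof
    assume "u = []"
    then have "a # u = replicate 0 LX @ [LY] \<or> a # u = replicate 0 LY @ [LX]"
      by (cases a) auto
    then show ?l unfolding special_word_def by blast
  next
    assume "\<exists>i b. b \<noteq> a \<and> u = replicate i a @ [b]"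
    then obtain i b where "b \<noteq> a" "u = replicate i a @ [b]" by auto
    then have "a # u = replicate (Suc i) LX @ [LY] \<or> a # u = replicate (Suc i) LY @ [LX]"
      by (cases a; cases b) auto
    then show ?l unfolding special_word_def by blast
  qed
qed

lemma factorizations_rec:
  "us \<in> factorizations v \<longleftrightarrow> us = [v] \<or>
     (\<exists>u us' w. us = u # us' \<and> special_word u \<and> v = u @ w \<and> us' \<in> factorizations w)"
proof (cases us)
  case (Cons u us')
  then show ?thesis by (cases "us' = []") (auto simp: factorizations_def)
qed (simp add: factorizations_def)

lemma factorizations_Nil: "factorizations [] = {[[]]}"
proof -
  have "us \<in> factorizations [] \<longleftrightarrow> us = [[]]" for us
    by (subst factorizations_rec) (auto simp: special_word_Nil)
  then show ?thesis by blast
qed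

text \<open>
  The three parts consist of the factorization with a single factor and of those with more, whose first
  factor is the letter \<open>a\<close> or a longer special word.
\<close>

lemma factorizations_Cons:
  "factorizations (a # v) =
     insert [a # v] ((#) [a] ` factorizations v \<union> extend_first_factor a ` run_factorizations a v)"
  (is "_ = insert _ (?A \<union> ?B)")
proof (intro equalityI subsetI)
  fix us assume "us \<in> factorizations (a # v)"
  then consider "us = [a # v]"
    | u us' w where "us = u # us'" "special_word u" "a # v = u @ w" "us' \<in> factorizations w"
    by (subst (asm) factorizations_rec) blast
  then show "us \<in> insert [a # v] (?A \<union> ?B)"
  proof cases
    case 2
    then obtain u' where u': "u = a # u'" "v = u' @ w"
      using special_word_Nil by (cases u) auto
    with 2 consider "u' = []" | i b where "b \<noteq> a" "u' = replicate i a @ [b]"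
      by (auto simp: special_word_Cons)
    then show ?thesis
    proof cases
      case 1 with 2 u' show ?thesis by auto
    next
      case (2 i b)
      then have "u' # us' \<in> run_factorizations a v"
        using u' \<open>us' \<in> factorizations w\<close> unfolding run_factorizations_def by blast
      then have "extend_first_factor a (u' # us') \<in> ?B" by blast
      then show ?thesis using u' \<open>us = u # us'\<close> by (simp add: extend_first_factor_def)
    qed
  qed simp
next
  fix us assume "us \<in> insert [a # v] (?A \<union> ?B)"
  then consider "us = [a # v]" | us' where "us = [a] # us'" "us' \<in> factorizations v"
    | i b w us' where "us = (a # replicate i a @ [b]) # us'" "b \<noteq> a" "v = (replicate i a @ [b]) @ w"
        "us' \<in> factorizations w"
    by (auto simp: run_factorizations_def extend_first_factor_def)
  then show "us \<in> factorizations (a # v)"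
  proof cases
    case 1 then show ?thesis by (subst factorizations_rec) simp
  next
    case 2 then show ?thesis
      by (subst factorizations_rec) (auto simp: special_word_Cons)
  next
    case 3
    have "special_word (a # replicate i a @ [b])"
      using 3(2) by (auto simp: special_word_Cons)
    with 3 show ?thesis by (subst factorizations_rec) auto
  qed
qed

lemma run_factorizations_Nil: "run_factorizations a [] = {}"
  by (auto simp: run_factorizations_def)

lemma run_factorizations_stop:
  assumes "b \<noteq> a"
  shows "run_factorizations a (b # v) = (#) [b] ` factorizations v"
proof (intro equalityI subsetI)
  fix us assume "us \<in> run_factorizations a (b # v)"
  then obtain us' i c w where *: "us = (replicate i a @ [c]) # us'" "b # v = (replicate i a @ [c]) @ w"
      "us' \<in> factorizations w"
    by (auto simp: run_factorizations_def)
  with assms have "i = 0" by (cases i) auto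
  with * show "us \<in> (#) [b] ` factorizations v" by auto
next
  fix us assume "us \<in> (#) [b] ` factorizations v"
  then obtain us' where "us = (replicate 0 a @ [b]) # us'" "us' \<in> factorizations v" by auto
  then show "us \<in> run_factorizations a (b # v)"
    using assms unfolding run_factorizations_def by fastforce
qed

lemma run_factorizations_go:
  "run_factorizations a (a # v) = extend_first_factor a ` run_factorizations a v"
proof (intro equalityI subsetI)
  fix us assume "us \<in> run_factorizations a (a # v)"
  then obtain us' i b w where *: "us = (replicate i a @ [b]) # us'" "b \<noteq> a"
      "a # v = (replicate i a @ [b]) @ w" "us' \<in> factorizations w"
    by (auto simp: run_factorizations_def)
  then obtain j where "i = Suc j" by (cases i) auto
  with * have "us = extend_first_factor a ((replicate j a @ [b]) # us')"
      "(replicate j a @ [b]) # us' \<in> run_factorizations a v"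
    by (auto simp: run_factorizations_def extend_first_factor_def)
  then show "us \<in> extend_first_factor a ` run_factorizations a v" by blast
next
  fix us assume "us \<in> extend_first_factor a ` run_factorizations a v"
  then obtain us' i b w where *: "us = (a # replicate i a @ [b]) # us'" "b \<noteq> a"
      "v = (replicate i a @ [b]) @ w" "us' \<in> factorizations w"
    by (auto simp: run_factorizations_def extend_first_factor_def)
  then have "us = (replicate (Suc i) a @ [b]) # us'" "a # v = (replicate (Suc i) a @ [b]) @ w"
    by auto
  with * show "us \<in> run_factorizations a (a # v)"
    unfolding run_factorizations_def by blast
qed

lemma finite_factorizations: "finite (factorizations v) \<and> (\<forall>a. finite (run_factorizations a v))"
proof (induction v)
  case Nil then show ?case by (simp add: factorizations_Nil run_factorizations_Nil)
next
  case (Cons c v)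
  have "finite (run_factorizations a (c # v))" for a
    using Cons by (cases "c = a") (auto simp: run_factorizations_go run_factorizations_stop)
  with Cons show ?case by (simp add: factorizations_Cons)
qed

lemma run_factorizations_hd:
  "us \<in> run_factorizations a v \<Longrightarrow> us \<noteq> [] \<and> hd us \<noteq> [] \<and> tl us \<noteq> []"
  by (auto simp: run_factorizations_def factorizations_def)

lemma weight_cons: "weight ((#) u ` S) = ([:0, 1:] + 1) * weight S"
  by (simp add: weight_def sum.reindex sum_distrib_left)

lemma weight_extend_first_factor:
  "weight (extend_first_factor a ` run_factorizations a v) = weight (run_factorizations a v)"
proof -
  have inj: "inj_on (extend_first_factor a) (run_factorizations a v)"
    by (auto simp: inj_on_def extend_first_factor_def dest!: run_factorizations_hd intro: list.expand)
  have "length (extend_first_factor a us) = length us" if "us \<in> run_factorizations a v" for us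
    using run_factorizations_hd[OF that] by (simp add: extend_first_factor_def)
  then show ?thesis
    by (simp add: weight_def sum.reindex[OF inj])
qed

lemma weight_run_factorizations_Nil: "weight (run_factorizations a []) = 0"
  by (simp add: weight_def run_factorizations_Nil)

lemma weight_run_factorizations_Cons:
  "weight (run_factorizations a (b # v)) =
     (if b = a then weight (run_factorizations a v) else ([:0, 1:] + 1) * weight (factorizations v))"
proof (cases "b = a")
  case True
  show ?thesis unfolding True run_factorizations_go weight_extend_first_factor by simp
next
  case False
  show ?thesis unfolding run_factorizations_stop[OF False] weight_cons using False by simp
qed

lemma weight_factorizations_Nil: "weight (factorizations []) = [:0, 1:] + 1"
  by (simp add: weight_def factorizations_Nil)

lemma weight_factorizations_Cons:
  "weight (factorizations (a # v)) =
     ([:0, 1:] + 1) * (1 + weight (factorizations v)) + weight (run_factorizations a v)"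
proof -
  let ?A = "(#) [a] ` factorizations v" and ?B = "extend_first_factor a ` run_factorizations a v"
  have ne: "us \<noteq> []" if "us \<in> factorizations v" for us
    using that by (simp add: factorizations_def)
  have fin: "finite ?A" "finite ?B" using finite_factorizations by auto
  \<comment> \<open>The first factor has length 1 in \<open>?A\<close> and length at least 2 in \<open>?B\<close>, and only \<open>[a # v]\<close> has a single factor.\<close>
  have disj: "?A \<inter> ?B = {}" "[a # v] \<notin> ?A \<union> ?B"
    using ne run_factorizations_hd by (fastforce simp: extend_first_factor_def)+
  have "weight (factorizations (a # v)) = ([:0, 1:] + 1) + weight (?A \<union> ?B)"
    unfolding weight_def factorizations_Cons using fin disj by (subst sum.insert) auto
  also have "weight (?A \<union> ?B) = weight ?A + weight ?B"
    unfolding weight_def using fin disj by (intro sum.union_disjoint)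
  finally show ?thesis
    by (simp add: weight_cons weight_extend_first_factor algebra_simps)
qed

section \<open>Comparing the two recurrences\<close>

text \<open>
  Put \<open>Z\<close>, \<open>I\<close>, \<open>O\<close> for the enumerators of \<open>v\<close> after \<open>Zero\<close>, \<open>Fresh\<close>, \<open>One\<close>, and \<open>F = Z + t I + O\<close> for that
  of \<open>x v\<close> after \<open>Zero\<close>; further \<open>A\<close> for the sum over \<open>run_factorizations LX v\<close> and \<open>G\<close> for that over
  \<open>factorizations v\<close>.  Both transfer matrices preserve \<open>I + 1 = Z + O\<close>.

  Prepending \<open>x\<close> changes \<open>F\<close> into \<open>F + (1 + t) (F - Z)\<close>, which is \<open>1 + A + (1 + t) F\<close> by the second
  identity for \<open>v\<close>.  Since \<open>Z\<close> becomes \<open>F\<close> and \<open>A\<close> does not change, this is the second identity for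
  \<open>x v\<close>; with \<open>F = 1 + G\<close> it is the fourth as well.  Prepending \<open>y\<close> changes \<open>F\<close> into
  \<open>F + (1 + t) (F - O)\<close>, leaves \<open>Z\<close> alone and changes \<open>A\<close> into \<open>(1 + t) G = (1 + t) (F - 1)\<close>, so the
  second identity for \<open>y v\<close> says \<open>F = (1 + t) (Z + O) - t\<close>.  This is \<open>F = Z + t I + O\<close> with \<open>I\<close> replaced
  by \<open>Z + O - 1\<close>.  The third identity is the mirror image of the second, and it gives the fourth for
  \<open>y v\<close>.
\<close>

lemma transfer_identities:
  "pattern_poly v Fresh + 1 = pattern_poly v Zero + pattern_poly v One"
  "pattern_poly (LX # v) Zero = 1 + weight (run_factorizations LX v) +
     ([:0, 1:] + 1) * pattern_poly v Zero"
  "pattern_poly (LX # v) Zero = 1 + weight (run_factorizations LY v) +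
     ([:0, 1:] + 1) * pattern_poly v One"
  "pattern_poly (LX # v) Zero = 1 + weight (factorizations v)"
proof (induction v)
  case Nil
  {
    case 1 show ?case by simp
    case 2 show ?case by (simp add: pattern_poly_LX_Zero weight_run_factorizations_Nil)
    case 3 show ?case by (simp add: pattern_poly_LX_Zero weight_run_factorizations_Nil)
    case 4 show ?case by (simp add: pattern_poly_LX_Zero weight_factorizations_Nil)
  }
next
  case (Cons c v)
  note rec = pattern_poly_LX_Zero pattern_poly_LX_One pattern_poly_LX_Fresh
      pattern_poly_LY_Zero pattern_poly_LY_One pattern_poly_LY_Fresh
  \<comment> \<open>The simplifier would turn a product with \<open>[:0, 1:]\<close> into a shift of coefficients, which hides the
    ring identities; an opaque \<open>t\<close> prevents this.\<close>
  define t :: "int poly" where "t = [:0, 1:]"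
  note IH = Cons.IH[unfolded rec, folded t_def]
  note rec' = rec[folded t_def] weight_factorizations_Cons[folded t_def]
      weight_run_factorizations_Cons[folded t_def] letter.distinct if_True if_False refl
  have fresh: "pattern_poly v Fresh = pattern_poly v Zero + pattern_poly v One - 1"
    using IH(1) by (simp add: algebra_simps)
  have runs: "weight (run_factorizations LX v) =
        pattern_poly v Zero + t * pattern_poly v Fresh + pattern_poly v One - 1 - (t + 1) * pattern_poly v Zero"
    "weight (run_factorizations LY v) =
        pattern_poly v Zero + t * pattern_poly v Fresh + pattern_poly v One - 1 - (t + 1) * pattern_poly v One"
    "weight (factorizations v) = pattern_poly v Zero + t * pattern_poly v Fresh + pattern_poly v One - 1"
    using IH(2-4) by (simp_all add: algebra_simps)
  {
    case 1 show ?case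
      by (cases c) (simp_all add: rec' runs fresh algebra_simps)
    case 2 show ?case unfolding t_def[symmetric]
      by (cases c) (simp_all add: rec' runs fresh algebra_simps)
    case 3 show ?case unfolding t_def[symmetric]
      by (cases c) (simp_all add: rec' runs fresh algebra_simps)
    case 4 show ?case unfolding t_def[symmetric]
      by (cases c) (simp_all add: rec' runs fresh algebra_simps)
  }
qed

theorem corollary3p3:
  fixes v :: xyword and e :: "nat \<Rightarrow> 'n::finite"
  assumes "bij_betw e {..length v} (UNIV :: 'n set)"
  shows "f_polynomial (descent_polytope e v) =
           1 + (\<Sum>us \<in> factorizations v. ([:0, 1:] + 1) ^ length us)"
proof -
  let ?\<tau> = "\<lambda>x. encode 0 (coords e (length v) x)"
  have "f_polynomial (descent_polytope e v) =
      (\<Sum>p \<in> ?\<tau> ` descent_polytope e v. monom 1 (count_list p Fresh))"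
    unfolding descent_polytope_eq_solutions
    by (rule dp.f_polynomial_eq_sum_over_codes)
      (simp_all add: encode_coords_eq_iff tight_eq_iff dim_eq_count_Fresh[OF assms])
  also have "\<dots> = pattern_poly (LX # v) Zero"
    by (simp only: encode_descent_polytope[OF assms] pattern_poly_def)
  also have "\<dots> = 1 + weight (factorizations v)"
    by (rule transfer_identities)
  finally show ?thesis by (simp only: weight_def)
qed

end
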